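(* For any positive integers $r\le d$ and any positive integer $s$, $$N_{d,r}(s)=\sum_{\mu=0}^{\left\lceil \frac{s-1}{d+1}\right\rceil}\binom{s+d-d\mu-1}{\mu}+(r-1)\sum_{\mu=0}^{\left\lceil \frac{s-2d-1}{d+1}\right\rceil}\binom{s-d-d\mu-1}{\mu}.$$
   Context: A partition $\lambda=(\lambda_1,\dots,\lambda_k)$ is a finite nonincreasing sequence of positive integers (the empty partition is allowed). In its Young diagram (row $i$ has $\lambda_i$ left-justified cells), the hook length $h(i,j)$ of cell $(i,j)$ is $1$ plus the number of cells to its right in its row plus the number of cells below it in its column. For a positive integer $t$, $\lambda$ is $t$-core if no cell has hook length $t$; it is $(s,s+r)$-core if it is both $s$-core and $(s+r)$-core. $\lambda$ has $d$-distinct parts if $\lambda_i-\lambda_{i+1}\ge d$ for all $1\le i\le k-1$. For positive integers $d,r,s$, $N_{d,r}(s)$ is the number of $(s,s+r)$-core partitions with $d$-distinct parts. $\lceil x\rceil$ is the least integer $\ge x$. A sum whose upper limit is less than its lower limit equals $0$, and $\binom{n}{k}=0$ when $k>n\ge 0$. *)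

theory Defs
  imports Complex_Main
begin

definition is_partition :: "nat list \<Rightarrow> bool" where
  "is_partition l \<longleftrightarrow> sorted_wrt (\<ge>) l \<and> (\<forall>p\<in>set l. 0 < p)"

(* Rows and columns are indexed from 0, so the cell (i, j) here is the cell (i+1, j+1)
   of the usual 1-based convention. *)
definition young_diagram :: "nat list \<Rightarrow> (nat \<times> nat) set" where
  "young_diagram l = {(i, j). i < length l \<and> j < l ! i}"

definition hook_length :: "nat list \<Rightarrow> nat \<Rightarrow> nat \<Rightarrow> nat" where
  "hook_length l i j =
     1 + card {j'. j < j' \<and> (i, j') \<in> young_diagram l}
       + card {i'. i < i' \<and> (i', j) \<in> young_diagram l}"

definition is_core :: "nat \<Rightarrow> nat list \<Rightarrow> bool" where
  "is_core t l \<longleftrightarrow> (\<forall>(i, j)\<in>young_diagram l. hook_length l i j \<noteq> t)"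

definition distinct_parts :: "nat \<Rightarrow> nat list \<Rightarrow> bool" where
  "distinct_parts d l \<longleftrightarrow>
     (\<forall>i. Suc i < length l \<longrightarrow> int (l ! i) - int (l ! Suc i) \<ge> int d)"

definition core_partitions :: "nat \<Rightarrow> nat \<Rightarrow> nat \<Rightarrow> nat list set" where
  "core_partitions d r s =
     {l. is_partition l \<and> is_core s l \<and> is_core (s + r) l \<and> distinct_parts d l}"

definition N :: "nat \<Rightarrow> nat \<Rightarrow> nat \<Rightarrow> nat" where
  "N d r s = card (core_partitions d r s)"

end

theory Submission
  imports Defs
begin

text \<open>
  A partition is determined by the set of its first-column hook lengths, and having
  \<open>d\<close>-distinct parts means that two elements of this set differ by more than \<open>d\<close>.
  The partition is a \<open>t\<close>-core iff subtracting \<open>t\<close> from an element \<open>x \<ge> t\<close> of the set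
  stays in the set. If \<open>x \<ge> s + r\<close> were in the set of an \<open>(s, s + r)\<close>-core, so would be
  \<open>x - s\<close> and \<open>x - s - r\<close>, which are only \<open>r \<le> d\<close> apart. Hence all elements are below
  \<open>s + r\<close>, and the set is either a spaced subset of \<open>{1..s - 1}\<close>, or consists of \<open>j\<close> and
  \<open>s + j\<close> for one \<open>0 < j < r\<close> and a spaced subset of \<open>{j + d + 1..s + j - d - 1}\<close>.
\<close>

section \<open>First-column hook lengths\<close>

text \<open>For positive parts the first cell of the head row has \<open>a - 1\<close> cells to its
  right and \<open>length l\<close> below it, so its hook length is
  \<open>a + length l\<close>.\<close>

fun beta :: "nat list \<Rightarrow> nat list" where
  "beta [] = []"
| "beta (a # l) = (a + length l) # beta l"

lemma length_beta [simp]: "length (beta l) = length l"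
  by (induction l) auto

lemma beta_inject: "beta l = beta l' \<Longrightarrow> l = l'"
proof (induction l arbitrary: l')
  case Nil
  then show ?case by (cases l') auto
next
  case (Cons a l)
  then obtain b m where "l' = b # m" by (cases l') auto
  moreover from this Cons.prems have "length l = length m"
    by (metis length_beta length_Cons nat.inject)
  ultimately show ?case using Cons by auto
qed

lemma filter_le_id:
  fixes a j :: "'a::order"
  shows "\<forall>p\<in>set l. p \<le> a \<Longrightarrow> a \<le> j \<Longrightarrow> filter (\<lambda>p. p \<le> j) l = l"
  by (meson filter_True order_trans)

text \<open>Walking along the boundary of the diagram from its bottom left corner, the step across
  column \<open>j\<close> is preceded by \<open>j\<close> column steps and by one row step for each part of size at
  most \<open>j\<close>; the row steps are at the positions in \<open>beta l\<close>.\<close>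

lemma in_beta_iff:
  assumes "sorted_wrt (\<ge>) l"
  shows "m \<in> set (beta l) \<longleftrightarrow> (\<forall>j. m \<noteq> j + length (filter (\<lambda>p. p \<le> j) l))"
  using assms
proof (induction l)
  case Nil
  then show ?case by auto
next
  case (Cons a l)
  define f where "f j = j + length (filter (\<lambda>p. p \<le> j) l)" for j
  have le: "\<forall>p\<in>set l. p \<le> a" using Cons.prems by auto
  have big: "f j = j + length l" if "j \<ge> a" for j
    using filter_le_id[OF le that] by (simp add: f_def)
  have small: "f j < a + length l" if "j < a" for j
    using that length_filter_le[of "\<lambda>p. p \<le> j" l] unfolding f_def by linarith
  \<comment> \<open>A new largest part \<open>a\<close> adds a row step at
    \<open>a + length l = f a\<close> and moves the column steps from \<open>a\<close> on up by one.
    There \<open>f\<close> grows by exactly one per column, so \<open>f j + 1 = f (Suc j)\<close>,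
    and \<open>f a\<close> is the only value lost.\<close>
  have g: "j + length (filter (\<lambda>p. p \<le> j) (a # l)) = (if j < a then f j else f (Suc j))" for j
    using big[of j] big[of "Suc j"] by (auto simp: f_def)
  have IH: "m \<in> set (beta l) \<longleftrightarrow> (\<forall>j. m \<noteq> f j)"
    using Cons unfolding f_def by auto
  show ?case
  proof
    assume "m \<in> set (beta (a # l))"
    then consider "m = a + length l" | "\<forall>j. m \<noteq> f j" using IH by auto
    then show "\<forall>j. m \<noteq> j + length (filter (\<lambda>p. p \<le> j) (a # l))"
    proof cases
      case 1
      then show ?thesis unfolding g using small big
        by (metis add_right_cancel less_irrefl not_less_eq_eq le_Suc_eq not_le n_not_Suc_n)
    next
      case 2
      then show ?thesis unfolding g by auto
    qed
  next
    assume H: "\<forall>j. m \<noteq> j + length (filter (\<lambda>p. p \<le> j) (a # l))"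
    show "m \<in> set (beta (a # l))"
    proof (cases "m = a + length l")
      case False
      have "m \<noteq> f j" for j
      proof (cases "j \<le> a")
        case True
        then show ?thesis using H[unfolded g, rule_format, of j] big[of a] False
          by (cases "j = a") auto
      next
        case False
        then have "\<not> j - 1 < a" "Suc (j - 1) = j" by auto
        then show ?thesis using H[unfolded g, rule_format, of "j - 1"] by simp
      qed
      then show ?thesis using IH by auto
    qed auto
  qed
qed

section \<open>Hook lengths and the core condition\<close>

lemma hook_length_Cons_Suc: "hook_length (a # l) (Suc i) j = hook_length l i j"
proof -
  have "{i'. Suc i < i' \<and> (i', j) \<in> young_diagram (a # l)}
      = Suc ` {i'. i < i' \<and> (i', j) \<in> young_diagram l}"
    by (auto simp: young_diagram_def image_iff less_Suc_eq_0_disj Suc_less_eq2)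
  then show ?thesis
    by (simp add: hook_length_def card_image young_diagram_def)
qed

text \<open>The arm is \<open>a - j - 1\<close> and the leg counts the parts of \<open>l\<close>
  exceeding \<open>j\<close>. The hook length is thus the distance along the boundary from column
  step \<open>j\<close> to the row step of the head.\<close>

lemma hook_length_Cons_0:
  assumes "j < a"
  shows "hook_length (a # l) 0 j + j + length (filter (\<lambda>p. p \<le> j) l) = a + length l"
proof -
  have "{i'. 0 < i' \<and> (i', j) \<in> young_diagram (a # l)}
      = Suc ` {i'. i' < length l \<and> j < l ! i'}"
    by (auto simp: young_diagram_def image_iff gr0_conv_Suc)
  then have "card {i'. 0 < i' \<and> (i', j) \<in> young_diagram (a # l)}
      = length (filter (\<lambda>p. j < p) l)"
    by (simp add: card_image length_filter_conv_card)
  moreover have "{j'. j < j' \<and> (0, j') \<in> young_diagram (a # l)} = {j<..<a}"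
    by (auto simp: young_diagram_def)
  moreover have "length (filter (\<lambda>p. j < p) l) + length (filter (\<lambda>p. p \<le> j) l) = length l"
    using sum_length_filter_compl[of "\<lambda>p. j < p" l] by (simp add: not_less)
  ultimately show ?thesis using assms by (simp add: hook_length_def)
qed

lemma young_diagram_Cons:
  "young_diagram (a # l) = (\<lambda>j. (0, j)) ` {..<a} \<union> (\<lambda>(i, j). (Suc i, j)) ` young_diagram l"
  by (auto simp: young_diagram_def image_iff less_Suc_eq_0_disj)

lemma is_core_Cons:
  "is_core t (a # l) \<longleftrightarrow> (\<forall>j<a. hook_length (a # l) 0 j \<noteq> t) \<and> is_core t l"
  unfolding is_core_def young_diagram_Cons ball_Un
  by (auto simp: split_beta hook_length_Cons_Suc)

lemma beta_bound: "is_partition (a # l) \<Longrightarrow> x \<in> set (beta l) \<Longrightarrow> x < a + length l"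
proof (induction l arbitrary: a)
  case (Cons b l)
  then have "is_partition (b # l)" "b \<le> a" by (auto simp: is_partition_def)
  then show ?case using Cons by fastforce
qed auto

text \<open>The hook lengths in the top row are \<open>a + length l - f j\<close> for
  \<open>j < a\<close>. So \<open>t\<close> occurs there iff \<open>a + length l - t\<close> is the
  position of a column step, which by \<open>in_beta_iff\<close> means that it is not in
  \<open>beta l\<close>. The other rows follow by induction.\<close>

lemma is_core_iff:
  assumes "is_partition l" "0 < t"
  shows "is_core t l \<longleftrightarrow> (\<forall>x\<in>set (beta l). t \<le> x \<longrightarrow> x - t \<in> set (beta l))"
  using assms(1)
proof (induction l)
  case Nil
  then show ?case by (auto simp: is_core_def young_diagram_def)
next
  case (Cons a l)
  have l: "is_partition l" "sorted_wrt (\<ge>) l" "\<forall>p\<in>set l. p \<le> a"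
    using Cons.prems by (auto simp: is_partition_def)
  define f where "f j = j + length (filter (\<lambda>p. p \<le> j) l)" for j
  have big: "f j = j + length l" if "j \<ge> a" for j
    using filter_le_id[OF l(3) that] by (simp add: f_def)
  have hook: "hook_length (a # l) 0 j + f j = a + length l" if "j < a" for j
    using hook_length_Cons_0[OF that, of l] by (simp add: f_def)
  have row: "(\<forall>j<a. hook_length (a # l) 0 j \<noteq> t) \<longleftrightarrow>
      (t \<le> a + length l \<longrightarrow> a + length l - t \<in> set (beta l))"
  proof
    assume H: "\<forall>j<a. hook_length (a # l) 0 j \<noteq> t"
    show "t \<le> a + length l \<longrightarrow> a + length l - t \<in> set (beta l)"
    proof (intro impI, rule ccontr)
      assume t: "t \<le> a + length l" "a + length l - t \<notin> set (beta l)"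
      then obtain j where j: "a + length l - t = f j"
        using in_beta_iff[OF l(2)] unfolding f_def by blast
      \<comment> \<open>Column steps with \<open>j \<ge> a\<close> are at
        \<open>a + length l\<close> or higher, whereas \<open>t > 0\<close>.\<close>
      have "j < a" using big[of j] j t(1) assms(2) by (cases "j < a") auto
      then show False using H hook[of j] j t(1) by auto
    qed
  next
    assume H: "t \<le> a + length l \<longrightarrow> a + length l - t \<in> set (beta l)"
    show "\<forall>j<a. hook_length (a # l) 0 j \<noteq> t"
    proof (intro allI impI notI)
      fix j assume j: "j < a" "hook_length (a # l) 0 j = t"
      then have "t \<le> a + length l" "a + length l - t = f j" using hook[of j] by auto
      then show False using H in_beta_iff[OF l(2)] unfolding f_def by metis
    qed
  qed
  \<comment> \<open>The head entry is the strict maximum, so no difference reaches it, and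
    membership only concerns \<open>beta l\<close>.\<close>
  have "x - t \<noteq> a + length l" if "x \<in> set (beta (a # l))" "t \<le> x" for x
    using that beta_bound[OF Cons.prems, of x] assms(2) by auto
  then show ?case unfolding is_core_Cons row using Cons.IH[OF l(1)] by auto
qed

section \<open>Spaced sets\<close>

definition spaced :: "nat \<Rightarrow> nat set \<Rightarrow> bool" where
  "spaced d S \<longleftrightarrow> (\<forall>x\<in>S. \<forall>y\<in>S. x < y \<longrightarrow> x + d < y)"

section \<open>Partitions with distinct parts as spaced sets\<close>

lemma is_partition_Cons:
  "is_partition (a # l) \<longleftrightarrow> is_partition l \<and> 0 < a \<and> (l \<noteq> [] \<longrightarrow> hd l \<le> a)"
  by (cases l) (auto simp: is_partition_def)

lemma distinct_parts_Cons:
  "distinct_parts d (a # l) \<longleftrightarrow> distinct_parts d l \<and> (l \<noteq> [] \<longrightarrow> hd l + d \<le> a)"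
proof -
  have "(\<forall>i. Suc i < length (a # l) \<longrightarrow> int ((a # l) ! i) - int ((a # l) ! Suc i) \<ge> int d)
     \<longleftrightarrow> (\<forall>i. Suc i < length l \<longrightarrow> int (l ! i) - int (l ! Suc i) \<ge> int d) \<and>
         (l \<noteq> [] \<longrightarrow> hd l + d \<le> a)" (is "?L \<longleftrightarrow> ?R")
  proof
    assume L: ?L
    have "int (l ! i) - int (l ! Suc i) \<ge> int d" if "Suc i < length l" for i
      using L[rule_format, of "Suc i"] that by simp
    moreover have "hd l + d \<le> a" if "l \<noteq> []"
      using L[rule_format, of 0] that by (simp add: hd_conv_nth)
    ultimately show ?R by blast
  next
    assume R: ?R
    show ?L
    proof (intro allI impI)
      fix i assume "Suc i < length (a # l)"
      then show "int ((a # l) ! i) - int ((a # l) ! Suc i) \<ge> int d"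
        using R by (cases i) (auto simp: hd_conv_nth)
    qed
  qed
  then show ?thesis by (simp add: distinct_parts_def)
qed

text \<open>Consecutive entries of \<open>beta l\<close> differ by one more than the parts do, which
  turns gaps of at least \<open>d\<close> into gaps above \<open>d\<close>. The last entry is the
  last part, so excluding 0 makes all parts positive.\<close>

lemma partition_beta_iff:
  "is_partition l \<and> distinct_parts d l \<longleftrightarrow>
     sorted_wrt (\<lambda>x y. y + d < x) (beta l) \<and> 0 \<notin> set (beta l)"
proof (induction l)
  case Nil
  then show ?case by (simp add: is_partition_def distinct_parts_def)
next
  case (Cons a l)
  show ?case
  proof (cases l)
    case Nil
    then show ?thesis by (simp add: is_partition_def distinct_parts_def)
  next
    case (Cons b m)
    have "sorted_wrt (\<lambda>x y. y + d < x) (beta (a # l)) \<longleftrightarrow>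
        sorted_wrt (\<lambda>x y. y + d < x) (beta l) \<and> b + d \<le> a"
      using Cons by fastforce
    moreover have "is_partition (a # l) \<and> distinct_parts d (a # l) \<longleftrightarrow>
        (is_partition l \<and> distinct_parts d l) \<and> b + d \<le> a"
      unfolding is_partition_Cons[of a l] distinct_parts_Cons[of d a l]
      using Cons by (auto simp: is_partition_def)
    ultimately show ?thesis using Cons.IH Cons by auto
  qed
qed

text \<open>The head part has to be \<open>x - length xs\<close>. This is not truncated, because the
  entries of \<open>xs\<close> are distinct and lie in \<open>{1..<x}\<close>.\<close>

lemma ex_beta:
  "sorted_wrt (>) xs \<Longrightarrow> 0 \<notin> set xs \<Longrightarrow> \<exists>l. beta l = xs"
proof (induction xs)
  case (Cons x xs)
  then obtain l where l: "beta l = xs" by auto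
  have "distinct xs"
    using Cons.prems strict_sorted_iff[of "rev xs"] by (simp add: sorted_wrt_rev)
  moreover have "set xs \<subseteq> {1..<x}"
    using Cons.prems by (auto simp: Suc_le_eq intro!: gr0I)
  ultimately have "length xs \<le> x"
    using card_mono[of "{1..<x}" "set xs"] by (simp add: distinct_card)
  then have "beta ((x - length xs) # l) = x # xs"
    using l length_beta[of l] by simp
  then show ?case by blast
qed (auto intro: exI[of _ "[]"])

lemma sorted_wrt_spaced:
  assumes "sorted_wrt (>) xs"
  shows "sorted_wrt (\<lambda>x y. y + d < x) xs \<longleftrightarrow> spaced d (set xs)"
  using assms by (induction xs) (fastforce simp: spaced_def)+

text \<open>A finite set of positive integers has exactly one strictly decreasing listing, and this
  is \<open>beta l\<close> for exactly one \<open>l\<close>.\<close>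

lemma bij_betw_beta:
  "bij_betw (\<lambda>l. set (beta l)) {l. is_partition l \<and> distinct_parts d l}
     {S. finite S \<and> 0 \<notin> S \<and> spaced d S}"
proof -
  have dec: "sorted_wrt (>) (beta l)" if "is_partition l \<and> distinct_parts d l" for l
    using that unfolding partition_beta_iff by (auto elim!: sorted_wrt_mono_rel[rotated])
  have "inj_on (\<lambda>l. set (beta l)) {l. is_partition l \<and> distinct_parts d l}"
  proof (rule inj_onI)
    fix l l' assume "l \<in> {l. is_partition l \<and> distinct_parts d l}"
      "l' \<in> {l. is_partition l \<and> distinct_parts d l}" and eq: "set (beta l) = set (beta l')"
    then have "sorted_wrt (<) (rev (beta l))" "sorted_wrt (<) (rev (beta l'))"
      using dec by (auto simp: sorted_wrt_rev)
    then have "rev (beta l) = rev (beta l')"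
      using eq by (intro strict_sorted_equal) auto
    then show "l = l'" using beta_inject by simp
  qed
  moreover have "(\<lambda>l. set (beta l)) ` {l. is_partition l \<and> distinct_parts d l}
      = {S. finite S \<and> 0 \<notin> S \<and> spaced d S}" (is "?A = ?B")
  proof (intro equalityI subsetI)
    fix S assume "S \<in> ?A"
    then obtain l where l: "S = set (beta l)" "is_partition l \<and> distinct_parts d l" by auto
    then show "S \<in> ?B" using dec[OF l(2)] sorted_wrt_spaced partition_beta_iff by auto
  next
    fix S assume S: "S \<in> ?B"
    define xs where "xs = rev (sorted_list_of_set S)"
    have xs: "sorted_wrt (>) xs" "set xs = S"
      using S by (auto simp: xs_def sorted_wrt_rev)
    then obtain l where l: "beta l = xs" using ex_beta S by blast
    then have "is_partition l \<and> distinct_parts d l"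
      using xs S sorted_wrt_spaced partition_beta_iff by auto
    then show "S \<in> ?A" using l xs by auto
  qed
  ultimately show ?thesis by (simp add: bij_betw_def)
qed

section \<open>Counting spaced subsets of an interval\<close>

definition spaced_subsets :: "nat \<Rightarrow> nat \<Rightarrow> nat \<Rightarrow> nat set set" where
  "spaced_subsets d a n = {S. S \<subseteq> {a..<a + n} \<and> spaced d S}"

lemma finite_spaced_subsets [simp]: "finite (spaced_subsets d a n)"
  by (rule finite_subset[of _ "Pow {a..<a + n}"]) (auto simp: spaced_subsets_def)

text \<open>Split on whether the top point \<open>a + n\<close> is used; if it is, all others lie
  below \<open>a + n - d\<close>. For \<open>n \<le> d\<close> the truncated width 0 correctly
  leaves no others.\<close>

lemma spaced_subsets_Suc:
  "spaced_subsets d a (Suc n) =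
     spaced_subsets d a n \<union> insert (a + n) ` spaced_subsets d a (n - d)" (is "?L = ?R")
proof (intro equalityI subsetI)
  fix S assume S: "S \<in> ?L"
  show "S \<in> ?R"
  proof (cases "a + n \<in> S")
    case True
    have "a \<le> x \<and> x < a + (n - d)" if "x \<in> S - {a + n}" for x
    proof -
      have "x < a + n" "a \<le> x" using S that by (auto simp: spaced_subsets_def less_Suc_eq)
      moreover have "x + d < a + n" using S True that \<open>x < a + n\<close>
        by (auto simp: spaced_subsets_def spaced_def)
      ultimately show ?thesis by linarith
    qed
    then have "S - {a + n} \<subseteq> {a..<a + (n - d)}" by (meson atLeastLessThan_iff subsetI)
    then have "S - {a + n} \<in> spaced_subsets d a (n - d)"
      using S by (auto simp: spaced_subsets_def spaced_def)
    moreover have "S = insert (a + n) (S - {a + n})" using True by auto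
    ultimately show ?thesis by blast
  next
    case False
    then have "S \<subseteq> {a..<a + n}" using S by (force simp: spaced_subsets_def less_Suc_eq)
    then show ?thesis using S by (auto simp: spaced_subsets_def)
  qed
next
  fix S assume "S \<in> ?R"
  then show "S \<in> ?L"
  proof
    assume "S \<in> spaced_subsets d a n"
    then show ?thesis by (force simp: spaced_subsets_def)
  next
    assume "S \<in> insert (a + n) ` spaced_subsets d a (n - d)"
    then obtain T where T: "S = insert (a + n) T" "T \<subseteq> {a..<a + (n - d)}" "spaced d T"
      by (auto simp: spaced_subsets_def)
    have b: "a \<le> x \<and> x + d < a + n" if "x \<in> T" for x using T(2) that by force
    have "spaced d S" unfolding spaced_def
    proof (intro ballI impI)
      fix x y assume "x \<in> S" "y \<in> S" "x < y"
      then show "x + d < y" using b[of x] b[of y] T(1,3) by (auto simp: spaced_def)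
    qed
    moreover have "x \<in> {a..<a + Suc n}" if "x \<in> S" for x
      using b[of x] that T(1) by auto
    ultimately show ?thesis unfolding spaced_subsets_def by blast
  qed
qed

lemma card_spaced_subsets_Suc:
  "card (spaced_subsets d a (Suc n)) =
     card (spaced_subsets d a n) + card (spaced_subsets d a (n - d))"
proof -
  have ni: "a + n \<notin> T" if "T \<in> spaced_subsets d a k" "k \<le> n" for T k
    using that by (force simp: spaced_subsets_def)
  have "inj_on (insert (a + n)) (spaced_subsets d a (n - d))"
    using ni by (intro inj_onI) (metis Diff_insert_absorb diff_le_self)
  moreover have "spaced_subsets d a n \<inter> insert (a + n) ` spaced_subsets d a (n - d) = {}"
    using ni[of _ n] by auto
  ultimately show ?thesis
    by (simp add: spaced_subsets_Suc card_Un_disjoint card_image)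
qed

text \<open>Truncated subtraction is harmless below: a truncated upper index gives \<open>0 choose \<mu>\<close>
  with \<open>\<mu> > 0\<close>.\<close>

lemma choose_spaced_step:
  assumes "0 < d"
  shows "(Suc n + d - d * Suc k) choose Suc k =
     ((n + d - d * Suc k) choose Suc k) + (((n - d) + d - d * k) choose k)"
proof (cases "d * k \<le> n")
  \<comment> \<open>This is Pascal's rule with upper index \<open>n - d * k\<close>. For
    \<open>n < d\<close> truncation changes the last upper index, but then \<open>k = 0\<close> and
    the coefficient is 1 anyway.\<close>
  case True
  then have "Suc n + d - d * Suc k = Suc (n - d * k)" "n + d - d * Suc k = n - d * k" by auto
  moreover have "(n - d) + d - d * k = n - d * k" if "d \<le> n" using that by simp
  moreover have "k = 0" if "n < d"
    using True that by (cases k) auto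
  ultimately show ?thesis by (cases "d \<le> n") auto
next
  case False
  then have k: "0 < k" by (cases k) auto
  have "(n - d) + d - d * k = 0" using False k assms by (cases "d \<le> n") auto
  then show ?thesis using False k by auto
qed

text \<open>Both sides satisfy the same recurrence. The limit \<open>M\<close> is arbitrary above
  \<open>n\<close> so that the induction can use \<open>M\<close> for \<open>m\<close> and
  \<open>M - 1\<close> for \<open>m - d\<close>, whose sum gets shifted by one.\<close>

lemma card_spaced_subsets_long_sum:
  assumes "0 < d"
  shows "n < M \<Longrightarrow> card (spaced_subsets d a n) = (\<Sum>\<mu>\<le>M. (n + d - d * \<mu>) choose \<mu>)"
proof (induction n arbitrary: M rule: less_induct)
  case (less n)
  then obtain M' where M: "M = Suc M'" by (cases M) auto
  show ?case
  proof (cases n)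
    case 0
    have "spaced_subsets d a 0 = {{}}" by (auto simp: spaced_subsets_def spaced_def)
    then show ?thesis using 0 M by (simp add: sum.atMost_Suc_shift del: sum.atMost_Suc)
  next
    case (Suc m)
    have "card (spaced_subsets d a n) = (\<Sum>\<mu>\<le>M. (m + d - d * \<mu>) choose \<mu>)
        + (\<Sum>\<mu>\<le>M'. ((m - d) + d - d * \<mu>) choose \<mu>)"
      using less.IH[of m M] less.IH[of "m - d" M'] less.prems Suc M
        card_spaced_subsets_Suc[of d a m] by (simp del: sum.atMost_Suc)
    \<comment> \<open>The terms at index 0 are both 1; the second sum pairs with the terms
      \<open>Suc k\<close> of the first.\<close>
    also have "\<dots> = (\<Sum>\<mu>\<le>M. (Suc m + d - d * \<mu>) choose \<mu>)"
      unfolding M sum.atMost_Suc_shift choose_spaced_step[OF assms] sum.distrib by simp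
    finally show ?thesis using Suc by simp
  qed
qed

text \<open>The hypothesis on \<open>K\<close> puts the upper index below \<open>\<mu>\<close>
  whenever \<open>\<mu> > K\<close>, so the long sum can be cut at \<open>K\<close>.\<close>

lemma card_spaced_subsets:
  assumes "0 < d" "n + d < (d + 1) * Suc K"
  shows "card (spaced_subsets d a n) = (\<Sum>\<mu>\<le>K. (n + d - d * \<mu>) choose \<mu>)"
proof -
  have "card (spaced_subsets d a n) = (\<Sum>\<mu>\<le>Suc n + K. (n + d - d * \<mu>) choose \<mu>)"
    using assms(1) by (rule card_spaced_subsets_long_sum) simp
  also have "\<dots> = (\<Sum>\<mu>\<le>K. (n + d - d * \<mu>) choose \<mu>)"
  proof (rule sum.mono_neutral_right)
    show "\<forall>\<mu>\<in>{..Suc n + K} - {..K}. ((n + d - d * \<mu>) choose \<mu>) = 0"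
    proof
      fix \<mu> assume "\<mu> \<in> {..Suc n + K} - {..K}"
      then have "Suc K \<le> \<mu>" by auto
      then have "(d + 1) * Suc K \<le> (d + 1) * \<mu>" by (rule mult_le_mono2)
      then have "n + d < d * \<mu> + \<mu>" using assms(2) by simp
      then have "n + d - d * \<mu> < \<mu>" using \<open>Suc K \<le> \<mu>\<close> by linarith
      then show "((n + d - d * \<mu>) choose \<mu>) = 0" by simp
    qed
  qed auto
  finally show ?thesis .
qed

section \<open>Counting the cores\<close>

definition core_sets :: "nat \<Rightarrow> nat \<Rightarrow> nat \<Rightarrow> nat set set" where
  "core_sets d r s = {S. finite S \<and> 0 \<notin> S \<and> spaced d S \<and>
     (\<forall>x\<in>S. s \<le> x \<longrightarrow> x - s \<in> S) \<and> (\<forall>x\<in>S. s + r \<le> x \<longrightarrow> x - (s + r) \<in> S)}"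

lemma bij_betw_core_partitions:
  assumes "0 < s"
  shows "bij_betw (\<lambda>l. set (beta l)) (core_partitions d r s) (core_sets d r s)"
proof -
  have inj: "inj_on (\<lambda>l. set (beta l)) {l. is_partition l \<and> distinct_parts d l}"
    and im: "(\<lambda>l. set (beta l)) ` {l. is_partition l \<and> distinct_parts d l}
      = {S. finite S \<and> 0 \<notin> S \<and> spaced d S}"
    using bij_betw_beta[of d] by (auto simp: bij_betw_def)
  let ?C = "\<lambda>S. (\<forall>x\<in>S. s \<le> x \<longrightarrow> x - s \<in> S) \<and> (\<forall>x\<in>S. s + r \<le> x \<longrightarrow> x - (s + r) \<in> S)"
  have cp: "core_partitions d r s =
      {l. is_partition l \<and> distinct_parts d l} \<inter> {l. ?C (set (beta l))}"
    using assms by (auto simp: core_partitions_def is_core_iff)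
  have "(\<lambda>l. set (beta l)) ` core_partitions d r s
      = {S. finite S \<and> 0 \<notin> S \<and> spaced d S} \<inter> {S. ?C S}"
    unfolding cp im[symmetric] by blast
  also have "\<dots> = core_sets d r s" by (auto simp: core_sets_def)
  finally have "(\<lambda>l. set (beta l)) ` core_partitions d r s = core_sets d r s" .
  moreover have "inj_on (\<lambda>l. set (beta l)) (core_partitions d r s)"
    using inj unfolding cp by (rule inj_on_subset) (rule Int_lower1)
  ultimately show ?thesis by (simp add: bij_betw_def)
qed

text \<open>The guard is the spacing of \<open>j\<close> and \<open>s + j\<close>. The width is the
  size of \<open>{j + d + 1..s + j - d - 1}\<close>, truncated to 0 if nothing fits between
  them.\<close>

definition wrapped_sets :: "nat \<Rightarrow> nat \<Rightarrow> nat \<Rightarrow> nat set set" where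
  "wrapped_sets d s j =
     (if d < s then (\<lambda>T. insert j (insert (s + j) T)) ` spaced_subsets d (j + d + 1) (s - (2 * d + 1))
      else {})"

lemma core_sets_eq:
  assumes "0 < r" "0 < s" "r \<le> d"
  shows "core_sets d r s = spaced_subsets d 1 (s - 1) \<union> (\<Union>j\<in>{1..<r}. wrapped_sets d s j)"
    (is "?L = ?R")
proof (intro equalityI subsetI)
  fix S assume S: "S \<in> ?L"
  then have z: "0 \<notin> S" and sp: "\<And>x y. x \<in> S \<Longrightarrow> y \<in> S \<Longrightarrow> x < y \<Longrightarrow> x + d < y"
    and c1: "\<And>x. x \<in> S \<Longrightarrow> s \<le> x \<Longrightarrow> x - s \<in> S"
    and c2: "\<And>x. x \<in> S \<Longrightarrow> s + r \<le> x \<Longrightarrow> x - (s + r) \<in> S"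
    by (auto simp: core_sets_def spaced_def)
  have bound: "x < s + r" if "x \<in> S" for x
  proof (rule ccontr)
    assume "\<not> x < s + r"
    then have "x - (s + r) \<in> S" "x - s \<in> S" "x - (s + r) < x - s" "x - s \<le> x - (s + r) + d"
      using c1[OF that] c2[OF that] assms by auto
    then show False using sp by (meson not_le)
  qed
  have ns: "s \<notin> S" using c1[of s] z by auto
  show "S \<in> ?R"
  proof (cases "\<exists>x\<in>S. s \<le> x")
    case False
    then have "S \<in> spaced_subsets d 1 (s - 1)"
      using z sp by (auto simp: spaced_subsets_def spaced_def Suc_le_eq not_le intro!: gr0I)
    then show ?thesis by blast
  next
    case True
    then obtain x where x: "x \<in> S" "s \<le> x" by auto
    define j where "j = x - s"
    have "x \<noteq> s" using x ns by auto
    then have j: "j \<in> S" "s + j \<in> S" "0 < j" "j < r"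
      using x c1[of x] bound[of x] by (auto simp: j_def)
    have ds: "d < s" using sp[OF j(1,2)] assms by auto
    have "j + d + 1 \<le> y \<and> y + d < s + j" if "y \<in> S" "y \<noteq> j" "y \<noteq> s + j" for y
    proof -
      \<comment> \<open>Below \<open>j\<close> there is no room since \<open>j < r \<le> d\<close>;
        above \<open>s + j\<close> there is none since every element is below
        \<open>s + r\<close>.\<close>
      have "\<not> y < j" using sp[of y j] that j assms by auto
      moreover have "\<not> s + j < y" using sp[of "s + j" y] bound[of y] that j assms by auto
      ultimately show ?thesis using sp[of j y] sp[of y "s + j"] that j by auto
    qed
    then have "S - {j, s + j} \<in> spaced_subsets d (j + d + 1) (s - (2 * d + 1))"
      using sp by (fastforce simp: spaced_subsets_def spaced_def)
    moreover have "S = insert j (insert (s + j) (S - {j, s + j}))" using j by auto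
    ultimately have "S \<in> wrapped_sets d s j" using ds unfolding wrapped_sets_def by auto
    then show ?thesis using j by auto
  qed
next
  fix S assume "S \<in> ?R"
  then consider "S \<in> spaced_subsets d 1 (s - 1)"
    | j where "0 < j" "j < r" "S \<in> wrapped_sets d s j" by (auto simp: Suc_le_eq)
  then show "S \<in> ?L"
  proof cases
    case 1
    then have "\<forall>x\<in>S. 0 < x \<and> x < s" "spaced d S" "finite S"
      using assms by (auto simp: spaced_subsets_def intro: finite_subset)
    then show ?thesis by (auto simp: core_sets_def)
  next
    case 2
    then have ds: "d < s" by (auto simp: wrapped_sets_def split: if_splits)
    with 2 obtain T where T: "S = insert j (insert (s + j) T)"
      "T \<in> spaced_subsets d (j + d + 1) (s - (2 * d + 1))"
      by (auto simp: wrapped_sets_def)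
    have b: "j + d < y \<and> y + d < s + j" if "y \<in> T" for y
      using T(2) that by (force simp: spaced_subsets_def)
    have spT: "spaced d T" "finite T" using T(2) by (auto simp: spaced_subsets_def intro: finite_subset)
    have "spaced d S" unfolding spaced_def
    proof (intro ballI impI)
      fix x y assume xy: "x \<in> S" "y \<in> S" "x < y"
      show "x + d < y"
        using xy b[of x] b[of y] spT(1) ds unfolding T(1) spaced_def by auto
    qed
    moreover have "0 \<notin> S" using T(1) b 2 by fastforce
    \<comment> \<open>Since \<open>j < r \<le> d < s\<close>, both \<open>j\<close> and all of
      \<open>T\<close> are below \<open>s\<close>. So the \<open>s\<close> condition is only tested
      at \<open>s + j\<close>, and the \<open>s + r\<close> condition never.\<close>
    moreover have top: "x = s + j" if "x \<in> S" "s \<le> x" for x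
      using that T(1) b[of x] ds 2 assms by auto
    have "x - s \<in> S" if "x \<in> S" "s \<le> x" for x
      using top[OF that] T(1) by simp
    moreover have "\<not> s + r \<le> x" if "x \<in> S" for x
      using top[OF that] 2 by auto
    moreover have "finite S" using T(1) spT(2) by simp
    ultimately show ?thesis unfolding core_sets_def by blast
  qed
qed

text \<open>In a wrapped set \<open>s + j\<close> is the only element not below \<open>s\<close>. It
  determines \<open>j\<close>, so the families are disjoint from each other and from the subsets of
  \<open>{1..s - 1}\<close>, and the \<open>r - 1\<close> of them have equal size.\<close>

lemma card_core_sets:
  assumes "0 < d" "0 < r" "0 < s" "r \<le> d"
  shows "finite (core_sets d r s)"
    and "card (core_sets d r s) = card (spaced_subsets d 1 (s - 1)) +
      (r - 1) * (if d < s then card (spaced_subsets d 1 (s - (2 * d + 1))) else 0)"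
proof -
  have fin: "finite (wrapped_sets d s j)" for j by (simp add: wrapped_sets_def)
  then show "finite (core_sets d r s)" using assms by (simp add: core_sets_eq)
  have top: "x = s + j" if "S \<in> wrapped_sets d s j" "j < r" "x \<in> S" "s \<le> x" for S j x
    using that assms by (force simp: wrapped_sets_def spaced_subsets_def split: if_splits)
  have mem: "s + j \<in> S" if "S \<in> wrapped_sets d s j" for S j
    using that by (auto simp: wrapped_sets_def split: if_splits)
  have card1: "card (wrapped_sets d s j) =
      (if d < s then card (spaced_subsets d 1 (s - (2 * d + 1))) else 0)" for j
  proof -
    have "inj_on (\<lambda>T. insert j (insert (s + j) T)) (spaced_subsets d (j + d + 1) (s - (2 * d + 1)))"
    proof (rule inj_onI)
      fix T U assume TU: "T \<in> spaced_subsets d (j + d + 1) (s - (2 * d + 1))"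
        "U \<in> spaced_subsets d (j + d + 1) (s - (2 * d + 1))"
        "insert j (insert (s + j) T) = insert j (insert (s + j) U)"
      then have "j \<notin> T" "s + j \<notin> T" "j \<notin> U" "s + j \<notin> U"
        by (force simp: spaced_subsets_def)+
      then have "T = insert j (insert (s + j) T) - {j, s + j}"
        "U = insert j (insert (s + j) U) - {j, s + j}" by blast+
      then show "T = U" using TU(3) by simp
    qed
    \<comment> \<open>Translation invariance is read off the closed formula, which does not mention
      the left end.\<close>
    moreover have "card (spaced_subsets d a n) = card (spaced_subsets d 1 n)" for a n
      using card_spaced_subsets_long_sum[OF assms(1), of n "Suc n"] by simp
    ultimately show ?thesis by (simp add: wrapped_sets_def card_image)
  qed
  have "card (\<Union>j\<in>{1..<r}. wrapped_sets d s j) = (\<Sum>j\<in>{1..<r}. card (wrapped_sets d s j))"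
  proof (rule card_UN_disjoint)
    show "\<forall>i\<in>{1..<r}. \<forall>j\<in>{1..<r}. i \<noteq> j \<longrightarrow> wrapped_sets d s i \<inter> wrapped_sets d s j = {}"
    proof (intro ballI impI, rule ccontr)
      fix i j assume ij: "i \<in> {1..<r}" "j \<in> {1..<r}" "i \<noteq> j"
        "wrapped_sets d s i \<inter> wrapped_sets d s j \<noteq> {}"
      then obtain S where "S \<in> wrapped_sets d s i" "S \<in> wrapped_sets d s j" by auto
      then show False using top[of S j "s + i"] mem[of S i] ij by auto
    qed
  qed (use fin in auto)
  moreover have "spaced_subsets d 1 (s - 1) \<inter> (\<Union>j\<in>{1..<r}. wrapped_sets d s j) = {}"
    using mem by (fastforce simp: spaced_subsets_def)
  ultimately show "card (core_sets d r s) = card (spaced_subsets d 1 (s - 1)) +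
      (r - 1) * (if d < s then card (spaced_subsets d 1 (s - (2 * d + 1))) else 0)"
    using assms fin by (simp add: core_sets_eq card_Un_disjoint card1)
qed

text \<open>Rounding up with divisor \<open>d + 1\<close> is rounding down after adding
  \<open>d\<close>. Both limits of the theorem arise, from \<open>m = s - 1 + d\<close> and
  \<open>m = s - d - 1\<close>.\<close>

lemma ceiling_divide_nat:
  "\<lceil>(real m - real d) / (real d + 1)\<rceil> = int (m div (d + 1))"
proof -
  define q where "q = m div (d + 1)"
  have "m = (d + 1) * q + m mod (d + 1)"
    unfolding q_def by (rule mult_div_mod_eq[symmetric])
  moreover have "m mod (d + 1) < d + 1" by simp
  ultimately have "m \<le> (d + 1) * q + d" "(d + 1) * q \<le> m" by linarith+
  then have "real m \<le> (real d + 1) * real q + real d" "(real d + 1) * real q \<le> real m"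
    by (metis of_nat_1 of_nat_add of_nat_le_iff of_nat_mult)+
  then have "\<lceil>(real m - real d) / (real d + 1)\<rceil> = int q"
    by (intro ceiling_unique) (auto simp: field_simps)
  then show ?thesis by (simp add: q_def)
qed

lemma sum_int_atLeastAtMost:
  "(\<Sum>\<mu>\<in>{0..int K}. f \<mu>) = (\<Sum>\<mu>\<le>K. f (int \<mu>))"
  by (rule sum.reindex_bij_witness[of _ int nat]) auto

lemma less_mult_Suc_div: "n < (d + 1) * Suc (n div (d + 1))" for n d :: nat
  using dividend_less_times_div[of "d + 1" n] by simp

theorem theorem3p2:
  fixes d r s :: nat
  assumes "0 < d" and "0 < r" and "0 < s" and "r \<le> d"
  shows "finite (core_partitions d r s) \<and>
    int (N d r s) =
      (\<Sum>\<mu>\<in>{0..\<lceil>(real s - 1) / (real d + 1)\<rceil>}.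
         int (nat (int s + int d - int d * \<mu> - 1) choose nat \<mu>))
      + (int r - 1) *
        (\<Sum>\<mu>\<in>{0..\<lceil>(real s - 2 * real d - 1) / (real d + 1)\<rceil>}.
           int (nat (int s - int d - int d * \<mu> - 1) choose nat \<mu>))"
proof -
  note bij = bij_betw_core_partitions[OF assms(3), of d r]
  have A: "(\<Sum>\<mu>\<in>{0..\<lceil>(real s - 1) / (real d + 1)\<rceil>}.
      int (nat (int s + int d - int d * \<mu> - 1) choose nat \<mu>))
      = int (card (spaced_subsets d 1 (s - 1)))"
  proof -
    have "\<lceil>(real s - 1) / (real d + 1)\<rceil> = int ((s - 1 + d) div (d + 1))"
      using ceiling_divide_nat[of "s - 1 + d" d] assms(3) by (simp add: of_nat_diff)
    \<comment> \<open>A negative integer index becomes 0 under \<open>nat\<close>, just as in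
      truncated subtraction.\<close>
    moreover have "nat (int s + int d - int d * int \<mu> - 1) = s - 1 + d - d * \<mu>" for \<mu>
      using assms(3) by (simp add: nat_diff_distrib' flip: of_nat_mult)
    ultimately show ?thesis
      using card_spaced_subsets[of d "s - 1" "(s - 1 + d) div (d + 1)" 1, OF assms(1) less_mult_Suc_div]
      by (simp add: sum_int_atLeastAtMost)
  qed
  have B: "(\<Sum>\<mu>\<in>{0..\<lceil>(real s - 2 * real d - 1) / (real d + 1)\<rceil>}.
      int (nat (int s - int d - int d * \<mu> - 1) choose nat \<mu>))
      = int (if d < s then card (spaced_subsets d 1 (s - (2 * d + 1))) else 0)"
  proof (cases "d < s")
    case True
    define K where "K = (s - d - 1) div (d + 1)"
    have c: "\<lceil>(real s - 2 * real d - 1) / (real d + 1)\<rceil> = int K"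
      using ceiling_divide_nat[of "s - d - 1" d] True
      by (simp add: K_def of_nat_diff algebra_simps)
    have n: "nat (int s - int d - int d * int \<mu> - 1) = s - d - 1 - d * \<mu>" for \<mu>
      using True by (simp flip: of_nat_mult)
    have "(\<Sum>\<mu>\<le>K. (s - d - 1 - d * \<mu>) choose \<mu>) = card (spaced_subsets d 1 (s - (2 * d + 1)))"
    proof (cases "2 * d < s")
      case True
      then have e: "s - (2 * d + 1) + d = s - d - 1" by simp
      show ?thesis
        using card_spaced_subsets[of d "s - (2 * d + 1)" K 1, unfolded e]
          assms(1) less_mult_Suc_div[of "s - d - 1" d] by (simp add: K_def)
    next
      \<comment> \<open>For \<open>d < s \<le> 2 * d\<close> only the term 1 at index 0 remains; it
        counts the empty set, that is, the bare pair \<open>j\<close>, \<open>s + j\<close>.\<close>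
      case False
      then have "K = 0" by (simp add: K_def)
      moreover have "spaced_subsets d 1 0 = {{}}" by (auto simp: spaced_subsets_def spaced_def)
      ultimately show ?thesis using False by simp
    qed
    then show ?thesis using True by (simp add: c n sum_int_atLeastAtMost flip: of_nat_sum)
  next
    \<comment> \<open>For \<open>s \<le> d\<close> the numerator is at most \<open>- d - 1\<close>,
      so the sum is empty, matching the absence of wrapped sets.\<close>
    case False
    then have "(real s - 2 * real d - 1) / (real d + 1) \<le> -1" by (simp add: field_simps)
    then have "\<lceil>(real s - 2 * real d - 1) / (real d + 1)\<rceil> \<le> -1" by linarith
    then show ?thesis using False by simp
  qed
  have "int (r - 1) = int r - 1" using assms(2) by simp
  then show ?thesis
    unfolding A B N_def bij_betw_same_card[OF bij] bij_betw_finite[OF bij]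
    using card_core_sets[OF assms] by simp
qed

end
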